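(* Let $\lambda_1,\lambda_2\ge 0$ and let $(\eta^{(t)})_{t\ge 0}$ be a sequence of positive learning rates (possibly varying with $t$). Let $0\le\psi_j\le k$ be integers, and suppose that the real weight $w_j$ evolves, for every $t$ with $\psi_j\le t<k$, by the FoBoS elastic net regularization update $$w_j^{(t+1)}=\operatorname{sgn}(w_j^{(t)})\left[\frac{|w_j^{(t)}|-\eta^{(t)}\lambda_1}{\eta^{(t)}\lambda_2+1}\right]_+ .$$ Define $\Phi(-1)=1$ and $\Phi(t)=\Phi(t-1)\cdot\frac{1}{1+\eta^{(t)}\lambda_2}$ for $t\ge 0$, and define $\beta(-1)=0$ and $\beta(t)=\beta(t-1)+\frac{\eta^{(t)}}{\Phi(t-1)}$ for $t\ge 0$. Then $$w_j^{(k)}=\operatorname{sgn}(w_j^{(\psi_j)})\left[\,|w_j^{(\psi_j)}|\,\frac{\Phi(k-1)}{\Phi(\psi_j-1)}-\Phi(k-1)\cdot\lambda_1\,\bigl(\beta(k-1)-\beta(\psi_j-1)\bigr)\right]_+ .$$ In particular, given stored values of $\Phi$ and $\beta$, the $k-\psi_j$ successive updates can be applied with a number of arithmetic operations bounded independently of $k-\psi_j$.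
   Context: Setting: a linear model with weight vector $w\in\mathbb{R}^d$ is trained by forward backward splitting (FoBoS) with elastic net regularization. Each iteration takes a gradient step $w^{(t+\frac12)}=w^{(t)}-\eta^{(t)}\nabla L_i(w^{(t)})$ on the unregularized loss of one example, and then sets $$w^{(t+1)}=\operatorname{argmin}_{w}\left(\tfrac12\|w-w^{(t+\frac12)}\|_2^2+\eta^{(t)}\lambda_1\|w\|_1+\tfrac12\eta^{(t)}\lambda_2\|w\|_2^2\right).$$ At time steps when the current example has feature value $x_{ij}=0$, one has $w_j^{(t+\frac12)}=w_j^{(t)}$, and the $j$-th coordinate of the minimizer is given by the update displayed in the claim. The superscript $(t)$ denotes the value at iteration $t$; $\psi_j$ is the last iteration at which the stored value of $w_j$ was current, and $k$ is the current iteration. Notation: $[x]_+=\max(x,0)$, and $\operatorname{sgn}(x)\in\{-1,0,1\}$ is the sign of $x$, with $\operatorname{sgn}(0)=0$. *)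

theory Defs
  imports Complex_Main
begin

definition fobos_elastic_net_updates ::
    "real \<Rightarrow> real \<Rightarrow> (nat \<Rightarrow> real) \<Rightarrow> nat \<Rightarrow> nat \<Rightarrow> (nat \<Rightarrow> real) \<Rightarrow> bool" where
  "fobos_elastic_net_updates l1 l2 \<eta> \<psi> k w \<longleftrightarrow>
     (\<forall>t. \<psi> \<le> t \<and> t < k \<longrightarrow>
        w (Suc t) = sgn (w t) * max ((\<bar>w t\<bar> - \<eta> t * l1) / (\<eta> t * l2 + 1)) 0)"

(* The caches are indexed by integers because they start at index -1; below -1 they are constant. *)

function Phi :: "real \<Rightarrow> (nat \<Rightarrow> real) \<Rightarrow> int \<Rightarrow> real" where
  "Phi l2 \<eta> t =
     (if t < 0 then 1 else Phi l2 \<eta> (t - 1) * (1 / (1 + \<eta> (nat t) * l2)))"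
  by auto
termination by (relation "measure (\<lambda>(_, _, t). nat (t + 1))") auto

function beta :: "real \<Rightarrow> (nat \<Rightarrow> real) \<Rightarrow> int \<Rightarrow> real" where
  "beta l2 \<eta> t =
     (if t < 0 then 0 else beta l2 \<eta> (t - 1) + \<eta> (nat t) / Phi l2 \<eta> (t - 1))"
  by auto
termination by (relation "measure (\<lambda>(_, _, t). nat (t + 1))") auto

(* The defining equations loop as rewrite rules. *)
declare Phi.simps [simp del] beta.simps [simp del]

lemma Phi_minus_one: "Phi l2 \<eta> (- 1) = 1"
  by (simp add: Phi.simps)

lemma Phi_rec: "t \<ge> 0 \<Longrightarrow> Phi l2 \<eta> t = Phi l2 \<eta> (t - 1) * (1 / (1 + \<eta> (nat t) * l2))"
  by (subst Phi.simps) simp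

lemma beta_minus_one: "beta l2 \<eta> (- 1) = 0"
  by (simp add: beta.simps)

lemma beta_rec: "t \<ge> 0 \<Longrightarrow> beta l2 \<eta> t = beta l2 \<eta> (t - 1) + \<eta> (nat t) / Phi l2 \<eta> (t - 1)"
  by (subst beta.simps) simp

(* Loop-free real arithmetic over the quantities available to a lazy update. There are no
   literals, and an expression can access the time indices, the learning rates and the
   trajectory only through the inputs below, so op_count is the cost of the computation
   for every choice of these data. Pos is the positive part. *)

datatype lazy_input =
  Weight | Lambda1 | Lambda2 | Phi_now | Phi_last | Beta_now | Beta_last

datatype arith =
    Input lazy_input
  | Add arith arith
  | Sub arith arith
  | Mul arith arith
  | Div arith arith
  | Abs arith
  | Sgn arith
  | Pos arith

primrec arith_value :: "(lazy_input \<Rightarrow> real) \<Rightarrow> arith \<Rightarrow> real" where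
  "arith_value \<sigma> (Input v) = \<sigma> v"
| "arith_value \<sigma> (Add a b) = arith_value \<sigma> a + arith_value \<sigma> b"
| "arith_value \<sigma> (Sub a b) = arith_value \<sigma> a - arith_value \<sigma> b"
| "arith_value \<sigma> (Mul a b) = arith_value \<sigma> a * arith_value \<sigma> b"
| "arith_value \<sigma> (Div a b) = arith_value \<sigma> a / arith_value \<sigma> b"
| "arith_value \<sigma> (Abs a) = \<bar>arith_value \<sigma> a\<bar>"
| "arith_value \<sigma> (Sgn a) = sgn (arith_value \<sigma> a)"
| "arith_value \<sigma> (Pos a) = max (arith_value \<sigma> a) 0"

primrec op_count :: "arith \<Rightarrow> nat" where
  "op_count (Input v) = 0"
| "op_count (Add a b) = Suc (op_count a + op_count b)"
| "op_count (Sub a b) = Suc (op_count a + op_count b)"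
| "op_count (Mul a b) = Suc (op_count a + op_count b)"
| "op_count (Div a b) = Suc (op_count a + op_count b)"
| "op_count (Abs a) = Suc (op_count a)"
| "op_count (Sgn a) = Suc (op_count a)"
| "op_count (Pos a) = Suc (op_count a)"

fun lazy_inputs ::
    "real \<Rightarrow> real \<Rightarrow> (nat \<Rightarrow> real) \<Rightarrow> nat \<Rightarrow> nat \<Rightarrow> real \<Rightarrow> lazy_input \<Rightarrow> real" where
  "lazy_inputs l1 l2 \<eta> \<psi> k x Weight = x"
| "lazy_inputs l1 l2 \<eta> \<psi> k x Lambda1 = l1"
| "lazy_inputs l1 l2 \<eta> \<psi> k x Lambda2 = l2"
| "lazy_inputs l1 l2 \<eta> \<psi> k x Phi_now = Phi l2 \<eta> (int k - 1)"
| "lazy_inputs l1 l2 \<eta> \<psi> k x Phi_last = Phi l2 \<eta> (int \<psi> - 1)"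
| "lazy_inputs l1 l2 \<eta> \<psi> k x Beta_now = beta l2 \<eta> (int k - 1)"
| "lazy_inputs l1 l2 \<eta> \<psi> k x Beta_last = beta l2 \<eta> (int \<psi> - 1)"

end

theory Submission
  imports Defs
begin

text \<open>
  A shrinkage step on the magnitude, \<open>a \<mapsto> (a - c) / D\<close> with \<open>c \<ge> 0\<close> and \<open>D > 0\<close>, keeps
  nonpositive values nonpositive. Hence truncation at 0 need not be done after every step: the
  affine maps can be composed first and truncated once at the end. The composed affine map is
  evaluated with \<open>\<Phi>\<close>, the product of the contraction factors, and \<open>\<beta>\<close>, the sum of the shifts
  rescaled by \<open>\<Phi>\<close>.
\<close>

text \<open>This removes the inner \<open>max\<close> left by the induction hypothesis. If
  \<open>a\<close> is positive, that \<open>max\<close> is inactive; otherwise both sides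
  vanish.\<close>

lemma shrink_truncated:
  fixes x a c d :: real
  assumes "c \<ge> 0" "d > 0"
  shows "sgn (sgn x * max a 0) * max ((\<bar>sgn x * max a 0\<bar> - c) / d) 0
         = sgn x * max ((a - c) / d) 0"
proof (cases "a > 0")
  case True
  then show ?thesis
    by (cases x "0::real" rule: linorder_cases) (auto simp: sgn_mult abs_mult)
next
  case False
  with assms have "(a - c) / d \<le> 0"
    by (simp add: divide_nonpos_pos)
  with False show ?thesis
    by simp
qed

text \<open>For use with \<open>p\<close>, \<open>q\<close> as values of \<open>Phi\<close> and
  \<open>b\<close>, \<open>c\<close> as values of \<open>beta\<close>. Writing the shift
  \<open>e * l\<close> as \<open>p * l * (e / p)\<close> absorbs it into the \<open>beta\<close>
  difference; this is why \<open>beta\<close> grows by \<eta> over \<open>Phi\<close>.\<close>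

lemma shrink_affine_step:
  fixes u p q l b c e d :: real
  assumes "p \<noteq> 0"
  shows "(u * (p / q) - p * l * (b - c) - e * l) / d
         = u * (p * (1 / d) / q) - p * (1 / d) * l * (b + e / p - c)"
proof -
  have "e * l = p * l * (e / p)"
    using assms by simp
  then have eq: "u * (p / q) - p * l * (b - c) - e * l = u * (p / q) - p * l * (b + e / p - c)"
    by (simp only:) (simp add: algebra_simps)
  show ?thesis
    unfolding eq by (simp only: diff_divide_distrib) (simp add: mult_ac)
qed

text \<open>The index \<open>int n - 1\<close> lets natural induction start at the cache index
  -1.\<close>

lemma Phi_pos:
  assumes "l2 \<ge> 0" "\<And>t. \<eta> t > 0"
  shows "Phi l2 \<eta> (int n - 1) > 0"
proof (induction n)
  case 0
  then show ?case
    by (simp add: Phi_minus_one)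
next
  case (Suc n)
  have "1 + \<eta> n * l2 > 0"
    using assms by (simp add: add_pos_nonneg less_imp_le)
  with Suc show ?case
    by (simp add: Phi_rec)
qed

lemma lazy_update:
  assumes "l1 \<ge> 0" "l2 \<ge> 0" and \<eta>: "\<And>t. \<eta> t > 0" and "\<psi> \<le> k"
    and upd: "fobos_elastic_net_updates l1 l2 \<eta> \<psi> k w"
  shows "w k = sgn (w \<psi>) *
        max (\<bar>w \<psi>\<bar> * (Phi l2 \<eta> (int k - 1) / Phi l2 \<eta> (int \<psi> - 1))
             - Phi l2 \<eta> (int k - 1) * l1 *
                 (beta l2 \<eta> (int k - 1) - beta l2 \<eta> (int \<psi> - 1))) 0"
  using \<open>\<psi> \<le> k\<close> upd
proof (induction k rule: dec_induct)
  case base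
  \<comment> \<open>The quotient of equal \<open>Phi\<close> values is 1 only for a nonzero
    denominator, since \<open>0 / 0 = 0\<close>.\<close>
  have "Phi l2 \<eta> (int \<psi> - 1) \<noteq> 0"
    using Phi_pos[of l2 \<eta> \<psi>] \<open>l2 \<ge> 0\<close> \<eta> by simp
  then show ?case
    by (simp add: sgn_mult_abs)
next
  case (step n)
  let ?a = "\<lambda>n. \<bar>w \<psi>\<bar> * (Phi l2 \<eta> (int n - 1) / Phi l2 \<eta> (int \<psi> - 1))
             - Phi l2 \<eta> (int n - 1) * l1 * (beta l2 \<eta> (int n - 1) - beta l2 \<eta> (int \<psi> - 1))"
  have pos: "\<eta> n * l2 + 1 > 0"
    using \<open>l2 \<ge> 0\<close> \<eta>[of n] by (simp add: add_nonneg_pos)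
  have "Phi l2 \<eta> (int n - 1) \<noteq> 0"
    using Phi_pos[of l2 \<eta> n] \<open>l2 \<ge> 0\<close> \<eta> by simp
  then have affine: "(?a n - \<eta> n * l1) / (\<eta> n * l2 + 1) = ?a (Suc n)"
    by (subst shrink_affine_step) (simp_all add: Phi_rec beta_rec add.commute)
  \<comment> \<open>The induction hypothesis applies because updates up to \<open>Suc n\<close>
    include those up to \<open>n\<close>.\<close>
  have "w n = sgn (w \<psi>) * max (?a n) 0"
    using step by (simp add: fobos_elastic_net_updates_def)
  moreover have "w (Suc n) = sgn (w n) * max ((\<bar>w n\<bar> - \<eta> n * l1) / (\<eta> n * l2 + 1)) 0"
    using step by (simp add: fobos_elastic_net_updates_def)
  ultimately have "w (Suc n) = sgn (w \<psi>) * max ((?a n - \<eta> n * l1) / (\<eta> n * l2 + 1)) 0"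
    using shrink_truncated[of "\<eta> n * l1" "\<eta> n * l2 + 1" "w \<psi>" "?a n"] pos \<open>l1 \<ge> 0\<close> \<eta>[of n]
    by simp
  then show ?case
    by (simp only: affine)
qed

text \<open>One syntax tree, chosen before \<psi>, \<open>k\<close> and the data, so its 10
  operations bound the cost uniformly.\<close>

definition lazy_update_program :: arith where
  "lazy_update_program =
     Mul (Sgn (Input Weight))
       (Pos (Sub (Mul (Abs (Input Weight)) (Div (Input Phi_now) (Input Phi_last)))
                 (Mul (Mul (Input Phi_now) (Input Lambda1))
                      (Sub (Input Beta_now) (Input Beta_last)))))"

theorem theorem2:
  "(\<forall>(l1::real) (l2::real) (\<eta>::nat \<Rightarrow> real) (\<psi>::nat) (k::nat) (w::nat \<Rightarrow> real).
      l1 \<ge> 0 \<longrightarrow> l2 \<ge> 0 \<longrightarrow> (\<forall>t. \<eta> t > 0) \<longrightarrow> \<psi> \<le> k \<longrightarrow>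
      fobos_elastic_net_updates l1 l2 \<eta> \<psi> k w \<longrightarrow>
      w k = sgn (w \<psi>) *
        max (\<bar>w \<psi>\<bar> * (Phi l2 \<eta> (int k - 1) / Phi l2 \<eta> (int \<psi> - 1))
             - Phi l2 \<eta> (int k - 1) * l1 *
                 (beta l2 \<eta> (int k - 1) - beta l2 \<eta> (int \<psi> - 1))) 0)
   \<and> (\<exists>(C::nat) (e::arith). op_count e \<le> C \<and>
      (\<forall>(l1::real) (l2::real) (\<eta>::nat \<Rightarrow> real) (\<psi>::nat) (k::nat) (w::nat \<Rightarrow> real).
         l1 \<ge> 0 \<longrightarrow> l2 \<ge> 0 \<longrightarrow> (\<forall>t. \<eta> t > 0) \<longrightarrow> \<psi> \<le> k \<longrightarrow>
         fobos_elastic_net_updates l1 l2 \<eta> \<psi> k w \<longrightarrow>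
         arith_value (lazy_inputs l1 l2 \<eta> \<psi> k (w \<psi>)) e = w k))"
proof (intro conjI exI)
  \<comment> \<open>Proving this instance fixes both existential witnesses.\<close>
  show "op_count lazy_update_program \<le> op_count lazy_update_program"
    by simp
\<comment> \<open>Without the deletion, \<open>a * (p / q)\<close> would become
  \<open>a * p / q\<close> and no longer match \<open>lazy_update\<close>.\<close>
qed (auto simp: lazy_update_program_def simp del: times_divide_eq_right
    intro: lazy_update lazy_update[symmetric])

end
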